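(* Let $\mathcal{J}$ be a small category and let $F:\mathcal{J}\rightarrow \mathbf{Cat}$ be a functor (a diagram of small categories). Let $F^*$ be the horizontal diagram in the double category $\mathbf{Prof}$ given by the composite $\mathcal{J}\xrightarrow{F}\mathbf{Cat}\xrightarrow{(\cdot)^*}\mathbf{Prof}_h$ of $F$ with the companion pseudofunctor. Then the Grothendieck construction of $F$ is the double colimit of $F^*$ in $\mathbf{Prof}$: $$\mathbf{Gro}(F)\cong \operatorname{dcolim} F^* .$$
   Context: Grothendieck construction. Write $\mathcal{C}_i=F(i)$ for $i\in\mathcal{J}$ and $F_\alpha:\mathcal{C}_i\to\mathcal{C}_j$ for the image of $\alpha:i\to j$. The category $\mathbf{Gro}(F)$ has as objects the disjoint union over $i\in\mathcal{J}$ of the objects of $\mathcal{C}_i$; a morphism from $x\in\mathcal{C}_i$ to $y\in\mathcal{C}_j$ is a pair $(\alpha,f)$ with $\alpha:i\to j$ in $\mathcal{J}$ and $f:F_\alpha x\to y$ in $\mathcal{C}_j$; composition is $(\beta,g)(\alpha,f)=(\beta\alpha,\,g\circ F_\beta(f))$. The double category $\mathbf{Prof}$. Objects: small categories. Vertical morphisms: functors. Horizontal morphisms $\mathcal{C}\to\mathcal{D}$: profunctors $u:\mathcal{C}^{op}\times\mathcal{D}\to\mathbf{Set}$. Horizontal unit of $\mathcal{C}$: the profunctor $\mathcal{C}(-,-)$. Horizontal composition of $u:\mathcal{C}^{op}\times\mathcal{D}\to\mathbf{Set}$ and $v:\mathcal{D}^{op}\times\mathcal{E}\to\mathbf{Set}$: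 the tensor product $v\otimes_{\mathcal D} u$, where $(v\otimes_{\mathcal D}u)(c,e)$ is the quotient of $\coprod_{d\in\mathcal{D}}v(d,e)\times u(c,d)$ by the equivalence relation generated by $(y,fx)\sim(yf,x)$ for $f:d\to d'$ in $\mathcal{D}$, $x\in u(c,d)$, $y\in v(d',e)$. A 2-cell with vertical sides $P:\mathcal{C}\to\mathcal{C}'$ (left) and $Q:\mathcal{D}\to\mathcal{D}'$ (right), top $u:\mathcal{C}^{op}\times\mathcal{D}\to\mathbf{Set}$ and bottom $v:\mathcal{C}'^{op}\times\mathcal{D}'\to\mathbf{Set}$, is a family of functions $u(c,d)\to v(Pc,Qd)$, natural in $c\in\mathcal{C}$ and $d\in\mathcal{D}$. Vertical and horizontal ($*$) compositions of 2-cells are the evident ones. $\mathbf{Prof}_h$ is the horizontal bicategory: small categories, profunctors, and 2-cells whose vertical sides are identities. Companions. The companion of a functor $P:\mathcal{C}\to\mathcal{D}$ is the profunctor $P^*(c,d)=\mathcal{D}(Pc,d)$. The assignment $P\mapsto P^*$ is a pseudofunctor $(\cdot)^*:\mathbf{Cat}\to\mathbf{Prof}_h$, the identity on objects, with $(1_{\mathcal{C}})^*=\mathcal{C}(-,-)$ and comparison isomorphisms $Q^*\otimes P^*\cong (QP)^*$ induced by $(g:Qd\to e,\ f:Pc\to d)\mapsto g\circ Q(f)$. Double colimits. Let $G,H:\mathcal{J}\to\mathbf{Prof}_h$ be pseudofunctors (horizontal diagrams), with invertible comparison 2-cells $\alpha_{f,g}:G(g)\otimes G(f)\Rightarrow G(gf)$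 and $\beta_{f,g}:H(g)\otimes H(f)\Rightarrow H(gf)$. A vertical transformation $\tau:G\Rightarrow H$ consists of a functor $\tau_i:G(i)\to H(i)$ for each $i\in\mathcal{J}$ and, for each $f:i\to j$ in $\mathcal{J}$, a 2-cell $\tau_f$ with top $G(f)$, bottom $H(f)$, left side $\tau_i$ and right side $\tau_j$, such that $\beta_{f,g}(\tau_g*\tau_f)\alpha_{f,g}^{-1}=\tau_{gf}$ for all composable $i\xrightarrow{f}j\xrightarrow{g}k$, and such that $\tau_{1_i}$ corresponds, under the unit isomorphisms of $G$ and $H$, to the unit 2-cell of $\tau_i$ (the 2-cell between horizontal units given by the action of $\tau_i$ on morphisms). Each category $\mathcal{D}$ determines a constant diagram, also denoted $\mathcal{D}$, sending all objects to $\mathcal{D}$ and all morphisms to the horizontal unit $\mathcal{D}(-,-)$, with structure isomorphisms the unitors. A functor $\mathcal{D}\to\mathcal{D}'$ acts on vertical transformations $G\Rightarrow\mathcal{D}$ by vertical composition. The double colimit $\operatorname{dcolim}G$ is a category equipped with a vertical transformation $G\Rightarrow\operatorname{dcolim}G$ such that every vertical transformation $G\Rightarrow\mathcal{D}$ to a constant diagram factors through it by a unique functor $\operatorname{dcolim}G\to\mathcal{D}$. *)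

theory Defs
  imports Main
begin

section \<open>Small categories and functors\<close>

text \<open>
  Hom-sets are indexed by their source and target and need not be disjoint, so composition,
  like every map on morphisms below, takes the objects involved as arguments:
  \<open>Comp C x y z g f\<close> is the composite of \<open>f : x \<rightarrow> y\<close> and \<open>g : y \<rightarrow> z\<close>.
  Only values on the carriers \<open>Ob\<close> and \<open>Hom\<close> are meaningful, so functors, 2-cells and
  transformations are compared with relations that ignore the values elsewhere.
\<close>

record ('o, 'a) category =
  Ob :: "'o set"
  Hom :: "'o \<Rightarrow> 'o \<Rightarrow> 'a set"
  Id :: "'o \<Rightarrow> 'a"
  Comp :: "'o \<Rightarrow> 'o \<Rightarrow> 'o \<Rightarrow> 'a \<Rightarrow> 'a \<Rightarrow> 'a"

locale is_category =
  fixes C :: "('o, 'a) category"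
  assumes Id_closed: "x \<in> Ob C \<Longrightarrow> Id C x \<in> Hom C x x"
    and Comp_closed:
      "\<lbrakk>x \<in> Ob C; y \<in> Ob C; z \<in> Ob C; f \<in> Hom C x y; g \<in> Hom C y z\<rbrakk>
        \<Longrightarrow> Comp C x y z g f \<in> Hom C x z"
    and Comp_Id_right:
      "\<lbrakk>x \<in> Ob C; y \<in> Ob C; f \<in> Hom C x y\<rbrakk> \<Longrightarrow> Comp C x x y f (Id C x) = f"
    and Comp_Id_left:
      "\<lbrakk>x \<in> Ob C; y \<in> Ob C; f \<in> Hom C x y\<rbrakk> \<Longrightarrow> Comp C x y y (Id C y) f = f"
    and Comp_assoc:
      "\<lbrakk>w \<in> Ob C; x \<in> Ob C; y \<in> Ob C; z \<in> Ob C;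
        f \<in> Hom C w x; g \<in> Hom C x y; h \<in> Hom C y z\<rbrakk>
        \<Longrightarrow> Comp C w x z (Comp C x y z h g) f = Comp C w y z h (Comp C w x y g f)"

record ('o, 'a, 'p, 'b) functor_data =
  FOb :: "'o \<Rightarrow> 'p"
  FHom :: "'o \<Rightarrow> 'o \<Rightarrow> 'a \<Rightarrow> 'b"

locale is_functor = C: is_category C + D: is_category D
  for C :: "('o, 'a) category" and D :: "('p, 'b) category" +
  fixes P :: "('o, 'a, 'p, 'b) functor_data"
  assumes FOb_closed: "x \<in> Ob C \<Longrightarrow> FOb P x \<in> Ob D"
    and FHom_closed:
      "\<lbrakk>x \<in> Ob C; y \<in> Ob C; f \<in> Hom C x y\<rbrakk> \<Longrightarrow> FHom P x y f \<in> Hom D (FOb P x) (FOb P y)"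
    and FHom_Id: "x \<in> Ob C \<Longrightarrow> FHom P x x (Id C x) = Id D (FOb P x)"
    and FHom_Comp:
      "\<lbrakk>x \<in> Ob C; y \<in> Ob C; z \<in> Ob C; f \<in> Hom C x y; g \<in> Hom C y z\<rbrakk>
        \<Longrightarrow> FHom P x z (Comp C x y z g f)
          = Comp D (FOb P x) (FOb P y) (FOb P z) (FHom P y z g) (FHom P x y f)"

definition id_functor :: "('o, 'a, 'o, 'a) functor_data" where
  "id_functor = \<lparr>FOb = (\<lambda>x. x), FHom = (\<lambda>x y f. f)\<rparr>"

definition comp_functor ::
  "('p, 'b, 'q, 'c) functor_data \<Rightarrow> ('o, 'a, 'p, 'b) functor_data \<Rightarrow> ('o, 'a, 'q, 'c) functor_data"
  where
  "comp_functor Q P =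
    \<lparr>FOb = (\<lambda>x. FOb Q (FOb P x)),
     FHom = (\<lambda>x y f. FHom Q (FOb P x) (FOb P y) (FHom P x y f))\<rparr>"

definition functor_eq ::
  "('o, 'a) category \<Rightarrow> ('o, 'a, 'p, 'b) functor_data \<Rightarrow> ('o, 'a, 'p, 'b) functor_data \<Rightarrow> bool"
  where
  "functor_eq C P Q \<longleftrightarrow>
    (\<forall>x\<in>Ob C. FOb P x = FOb Q x) \<and>
    (\<forall>x\<in>Ob C. \<forall>y\<in>Ob C. \<forall>f\<in>Hom C x y. FHom P x y f = FHom Q x y f)"

definition isomorphic_categories :: "('o, 'a) category \<Rightarrow> ('p, 'b) category \<Rightarrow> bool" where
  "isomorphic_categories C D \<longleftrightarrow>
    (\<exists>P Q. is_functor C D P \<and> is_functor D C Q \<and>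
      functor_eq C (comp_functor Q P) id_functor \<and> functor_eq D (comp_functor P Q) id_functor)"


section \<open>Functors to \<open>Cat\<close> and the Grothendieck construction\<close>

record ('i, 'j, 'o, 'a) diagram =
  DOb :: "'i \<Rightarrow> ('o, 'a) category"
  DArr :: "'i \<Rightarrow> 'i \<Rightarrow> 'j \<Rightarrow> ('o, 'a, 'o, 'a) functor_data"

locale is_Cat_diagram = J: is_category J for J :: "('i, 'j) category" +
  fixes F :: "('i, 'j, 'o, 'a) diagram"
  assumes DOb_category: "i \<in> Ob J \<Longrightarrow> is_category (DOb F i)"
    and DArr_functor:
      "\<lbrakk>i \<in> Ob J; j \<in> Ob J; \<alpha> \<in> Hom J i j\<rbrakk> \<Longrightarrow> is_functor (DOb F i) (DOb F j) (DArr F i j \<alpha>)"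
    and DArr_Id: "i \<in> Ob J \<Longrightarrow> functor_eq (DOb F i) (DArr F i i (Id J i)) id_functor"
    and DArr_Comp:
      "\<lbrakk>i \<in> Ob J; j \<in> Ob J; k \<in> Ob J; \<alpha> \<in> Hom J i j; \<beta> \<in> Hom J j k\<rbrakk>
        \<Longrightarrow> functor_eq (DOb F i) (DArr F i k (Comp J i j k \<beta> \<alpha>))
              (comp_functor (DArr F j k \<beta>) (DArr F i j \<alpha>))"

definition Gro :: "('i, 'j) category \<Rightarrow> ('i, 'j, 'o, 'a) diagram \<Rightarrow> ('i \<times> 'o, 'j \<times> 'a) category" where
  "Gro J F =
    \<lparr>Ob = (SIGMA i : Ob J. Ob (DOb F i)),
     Hom = (\<lambda>(i, x) (j, y). SIGMA \<alpha> : Hom J i j. Hom (DOb F j) (FOb (DArr F i j \<alpha>) x) y),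
     Id = (\<lambda>(i, x). (Id J i, Id (DOb F i) x)),
     Comp = (\<lambda>(i, x) (j, y) (k, z) (\<beta>, g) (\<alpha>, f).
       (Comp J i j k \<beta> \<alpha>,
        Comp (DOb F k)
          (FOb (DArr F j k \<beta>) (FOb (DArr F i j \<alpha>) x)) (FOb (DArr F j k \<beta>) y) z
          g (FHom (DArr F j k \<beta>) (FOb (DArr F i j \<alpha>) x) y f)))\<rparr>"


section \<open>Profunctors and their tensor product\<close>

text \<open>
  \<open>Act u c d c' d' a f\<close> is the value of \<open>u : C\<^sup>o\<^sup>p \<times> D \<rightarrow> Set\<close> at the morphism
  \<open>(c, d) \<rightarrow> (c', d')\<close> given by \<open>a : c' \<rightarrow> c\<close> and \<open>f : d \<rightarrow> d'\<close>.
\<close>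

record ('o, 'a, 'p, 'b, 'e) profunctor =
  El :: "'o \<Rightarrow> 'p \<Rightarrow> 'e set"
  Act :: "'o \<Rightarrow> 'p \<Rightarrow> 'o \<Rightarrow> 'p \<Rightarrow> 'a \<Rightarrow> 'b \<Rightarrow> 'e \<Rightarrow> 'e"

locale is_profunctor = C: is_category C + D: is_category D
  for C :: "('o, 'a) category" and D :: "('p, 'b) category" +
  fixes u :: "('o, 'a, 'p, 'b, 'e) profunctor"
  assumes Act_closed:
      "\<lbrakk>c \<in> Ob C; c' \<in> Ob C; d \<in> Ob D; d' \<in> Ob D;
        a \<in> Hom C c' c; f \<in> Hom D d d'; x \<in> El u c d\<rbrakk>
        \<Longrightarrow> Act u c d c' d' a f x \<in> El u c' d'"
    and Act_Id:
      "\<lbrakk>c \<in> Ob C; d \<in> Ob D; x \<in> El u c d\<rbrakk> \<Longrightarrow> Act u c d c d (Id C c) (Id D d) x = x"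
    and Act_Comp:
      "\<lbrakk>c \<in> Ob C; c' \<in> Ob C; c'' \<in> Ob C; d \<in> Ob D; d' \<in> Ob D; d'' \<in> Ob D;
        a \<in> Hom C c' c; a' \<in> Hom C c'' c'; f \<in> Hom D d d'; f' \<in> Hom D d' d''; x \<in> El u c d\<rbrakk>
        \<Longrightarrow> Act u c d c'' d'' (Comp C c'' c' c a a') (Comp D d d' d'' f' f) x
          = Act u c' d' c'' d'' a' f' (Act u c d c' d' a f x)"

definition hom_profunctor :: "('o, 'a) category \<Rightarrow> ('o, 'a, 'o, 'a, 'a) profunctor" where
  "hom_profunctor C =
    \<lparr>El = Hom C,
     Act = (\<lambda>c d c' d' a f x. Comp C c' d d' f (Comp C c' c d x a))\<rparr>"

text \<open>
  In the tensor product of \<open>u : C\<^sup>o\<^sup>p \<times> D \<rightarrow> Set\<close> and \<open>v : D\<^sup>o\<^sup>p \<times> E \<rightarrow> Set\<close>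
  a triple \<open>(d, y, x)\<close> stands for the element \<open>(y, x)\<close> of the summand \<open>v(d, e) \<times> u(c, d)\<close>.
\<close>

definition tensor_sum ::
  "('p, 'b) category \<Rightarrow> ('p, 'b, 'q, 'c, 'h) profunctor \<Rightarrow> ('o, 'a, 'p, 'b, 'e) profunctor
    \<Rightarrow> 'o \<Rightarrow> 'q \<Rightarrow> ('p \<times> 'h \<times> 'e) set" where
  "tensor_sum D v u c e = (SIGMA d : Ob D. El v d e \<times> El u c d)"

definition tensor_gen ::
  "('o, 'a) category \<Rightarrow> ('p, 'b) category \<Rightarrow> ('q, 'c) category
    \<Rightarrow> ('p, 'b, 'q, 'c, 'h) profunctor \<Rightarrow> ('o, 'a, 'p, 'b, 'e) profunctor
    \<Rightarrow> 'o \<Rightarrow> 'q \<Rightarrow> ('p \<times> 'h \<times> 'e) rel" where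
  "tensor_gen C D E v u c e =
    {((d', y, Act u c d c d' (Id C c) f x), (d, Act v d' e d e f (Id E e) y, x)) |d d' f x y.
      d \<in> Ob D \<and> d' \<in> Ob D \<and> f \<in> Hom D d d' \<and> x \<in> El u c d \<and> y \<in> El v d' e}"

definition tensor_rel ::
  "('o, 'a) category \<Rightarrow> ('p, 'b) category \<Rightarrow> ('q, 'c) category
    \<Rightarrow> ('p, 'b, 'q, 'c, 'h) profunctor \<Rightarrow> ('o, 'a, 'p, 'b, 'e) profunctor
    \<Rightarrow> 'o \<Rightarrow> 'q \<Rightarrow> ('p \<times> 'h \<times> 'e) rel" where
  "tensor_rel C D E v u c e =
    (tensor_gen C D E v u c e \<union> (tensor_gen C D E v u c e)\<inverse>)\<^sup>* \<inter>
    tensor_sum D v u c e \<times> tensor_sum D v u c e"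

definition tensor_class ::
  "('o, 'a) category \<Rightarrow> ('p, 'b) category \<Rightarrow> ('q, 'c) category
    \<Rightarrow> ('p, 'b, 'q, 'c, 'h) profunctor \<Rightarrow> ('o, 'a, 'p, 'b, 'e) profunctor
    \<Rightarrow> 'o \<Rightarrow> 'q \<Rightarrow> 'p \<times> 'h \<times> 'e \<Rightarrow> ('p \<times> 'h \<times> 'e) set" where
  "tensor_class C D E v u c e t = tensor_rel C D E v u c e `` {t}"

text \<open>
  Maps out of the tensor product are given on representatives: the union of the (equal) classes of
  the images when the target is again a tensor product, \<open>the_elem\<close> of the (singleton) set
  of values otherwise.
\<close>

definition tensor ::
  "('o, 'a) category \<Rightarrow> ('p, 'b) category \<Rightarrow> ('q, 'c) category
    \<Rightarrow> ('p, 'b, 'q, 'c, 'h) profunctor \<Rightarrow> ('o, 'a, 'p, 'b, 'e) profunctor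
    \<Rightarrow> ('o, 'a, 'q, 'c, ('p \<times> 'h \<times> 'e) set) profunctor" where
  "tensor C D E v u =
    \<lparr>El = (\<lambda>c e. tensor_sum D v u c e // tensor_rel C D E v u c e),
     Act = (\<lambda>c e c' e' a f X. \<Union>(d, y, x)\<in>X.
       tensor_class C D E v u c' e'
         (d, Act v d e d e' (Id D d) f y, Act u c d c' d a (Id D d) x))\<rparr>"

definition left_unitor ::
  "('o, 'a) category \<Rightarrow> ('o, 'a, 'p, 'b, 'e) profunctor
    \<Rightarrow> 'o \<Rightarrow> 'p \<Rightarrow> ('p \<times> 'b \<times> 'e) set \<Rightarrow> 'e" where
  "left_unitor C u c e X = the_elem ((\<lambda>(d, f, x). Act u c d c e (Id C c) f x) ` X)"


section \<open>2-cells\<close>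

text \<open>
  \<open>is_cell C D P Q u v t\<close>: \<open>t\<close> is a 2-cell with left side \<open>P\<close>, right side \<open>Q\<close>, top
  \<open>u : C\<^sup>o\<^sup>p \<times> D \<rightarrow> Set\<close> and bottom \<open>v\<close>.
\<close>

definition is_cell ::
  "('o, 'a) category \<Rightarrow> ('p, 'b) category
    \<Rightarrow> ('o, 'a, 'o2, 'a2) functor_data \<Rightarrow> ('p, 'b, 'p2, 'b2) functor_data
    \<Rightarrow> ('o, 'a, 'p, 'b, 'e) profunctor \<Rightarrow> ('o2, 'a2, 'p2, 'b2, 'h) profunctor
    \<Rightarrow> ('o \<Rightarrow> 'p \<Rightarrow> 'e \<Rightarrow> 'h) \<Rightarrow> bool" where
  "is_cell C D P Q u v t \<longleftrightarrow>
    (\<forall>c\<in>Ob C. \<forall>d\<in>Ob D. \<forall>x\<in>El u c d. t c d x \<in> El v (FOb P c) (FOb Q d)) \<and>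
    (\<forall>c\<in>Ob C. \<forall>c'\<in>Ob C. \<forall>d\<in>Ob D. \<forall>d'\<in>Ob D.
      \<forall>a\<in>Hom C c' c. \<forall>f\<in>Hom D d d'. \<forall>x\<in>El u c d.
        t c' d' (Act u c d c' d' a f x)
          = Act v (FOb P c) (FOb Q d) (FOb P c') (FOb Q d')
              (FHom P c' c a) (FHom Q d d' f) (t c d x))"

definition is_iso_cell ::
  "('o, 'a) category \<Rightarrow> ('p, 'b) category
    \<Rightarrow> ('o, 'a, 'p, 'b, 'e) profunctor \<Rightarrow> ('o, 'a, 'p, 'b, 'h) profunctor
    \<Rightarrow> ('o \<Rightarrow> 'p \<Rightarrow> 'e \<Rightarrow> 'h) \<Rightarrow> bool" where
  "is_iso_cell C D u v t \<longleftrightarrow>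
    is_cell C D id_functor id_functor u v t \<and>
    (\<forall>c\<in>Ob C. \<forall>d\<in>Ob D. bij_betw (t c d) (El u c d) (El v c d))"

definition inv_cell ::
  "('o, 'a, 'p, 'b, 'e) profunctor \<Rightarrow> ('o \<Rightarrow> 'p \<Rightarrow> 'e \<Rightarrow> 'h) \<Rightarrow> 'o \<Rightarrow> 'p \<Rightarrow> 'h \<Rightarrow> 'e" where
  "inv_cell u t c d = inv_into (El u c d) (t c d)"

definition cell_eq ::
  "('o, 'a) category \<Rightarrow> ('p, 'b) category \<Rightarrow> ('o, 'a, 'p, 'b, 'e) profunctor
    \<Rightarrow> ('o \<Rightarrow> 'p \<Rightarrow> 'e \<Rightarrow> 'h) \<Rightarrow> ('o \<Rightarrow> 'p \<Rightarrow> 'e \<Rightarrow> 'h) \<Rightarrow> bool" where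
  "cell_eq C D u s t \<longleftrightarrow> (\<forall>c\<in>Ob C. \<forall>d\<in>Ob D. \<forall>x\<in>El u c d. s c d x = t c d x)"

definition unit_cell :: "('o, 'a, 'p, 'b) functor_data \<Rightarrow> 'o \<Rightarrow> 'o \<Rightarrow> 'a \<Rightarrow> 'b" where
  "unit_cell P = FHom P"

text \<open>Vertical composition: \<open>P\<close> and \<open>Q\<close> are the sides of the upper cell \<open>t\<close>.\<close>

definition vcomp_cell ::
  "('o, 'a, 'o2, 'a2) functor_data \<Rightarrow> ('p, 'b, 'p2, 'b2) functor_data
    \<Rightarrow> ('o2 \<Rightarrow> 'p2 \<Rightarrow> 'h \<Rightarrow> 'k) \<Rightarrow> ('o \<Rightarrow> 'p \<Rightarrow> 'e \<Rightarrow> 'h) \<Rightarrow> 'o \<Rightarrow> 'p \<Rightarrow> 'e \<Rightarrow> 'k" where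
  "vcomp_cell P Q s t = (\<lambda>c d x. s (FOb P c) (FOb Q d) (t c d x))"

text \<open>
  Horizontal composition \<open>s * t\<close>, where \<open>t\<close> has sides \<open>P\<close>, \<open>Q\<close> and bottom \<open>u\<close>, and \<open>s\<close> has
  sides \<open>Q\<close>, \<open>R\<close> and bottom \<open>v\<close>, with \<open>u\<close> and \<open>v\<close> composable profunctors along \<open>C\<close>, \<open>D\<close>, \<open>E\<close>.
\<close>

definition hcomp_cell ::
  "('o2, 'a2) category \<Rightarrow> ('p2, 'b2) category \<Rightarrow> ('q2, 'c2) category
    \<Rightarrow> ('p2, 'b2, 'q2, 'c2, 'k) profunctor \<Rightarrow> ('o2, 'a2, 'p2, 'b2, 'l) profunctor
    \<Rightarrow> ('o, 'a, 'o2, 'a2) functor_data \<Rightarrow> ('p, 'b, 'p2, 'b2) functor_data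
    \<Rightarrow> ('q, 'c, 'q2, 'c2) functor_data
    \<Rightarrow> ('p \<Rightarrow> 'q \<Rightarrow> 'h \<Rightarrow> 'k) \<Rightarrow> ('o \<Rightarrow> 'p \<Rightarrow> 'e \<Rightarrow> 'l)
    \<Rightarrow> 'o \<Rightarrow> 'q \<Rightarrow> ('p \<times> 'h \<times> 'e) set \<Rightarrow> ('p2 \<times> 'k \<times> 'l) set" where
  "hcomp_cell C D E v u P Q R s t = (\<lambda>c e X. \<Union>(d, y, x)\<in>X.
    tensor_class C D E v u (FOb P c) (FOb R e) (FOb Q d, s d e y, t c d x))"


section \<open>Horizontal diagrams and vertical transformations\<close>

text \<open>
  The data of a pseudofunctor from \<open>J\<close> to the horizontal bicategory of profunctors.  For
  \<open>f : i \<rightarrow> j\<close> and \<open>g : j \<rightarrow> k\<close>, \<open>HComp G i j k f g\<close> is the comparison 2-cell from the tensor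
  product of \<open>G(g)\<close> and \<open>G(f)\<close> to \<open>G(gf)\<close>; \<open>HUnit G i\<close> is the one from the horizontal unit of
  \<open>G(i)\<close> to \<open>G(1\<^sub>i)\<close>.
\<close>

record ('i, 'j, 'o, 'a, 'e) hdiagram =
  HOb :: "'i \<Rightarrow> ('o, 'a) category"
  HPro :: "'i \<Rightarrow> 'i \<Rightarrow> 'j \<Rightarrow> ('o, 'a, 'o, 'a, 'e) profunctor"
  HComp :: "'i \<Rightarrow> 'i \<Rightarrow> 'i \<Rightarrow> 'j \<Rightarrow> 'j \<Rightarrow> 'o \<Rightarrow> 'o \<Rightarrow> ('o \<times> 'e \<times> 'e) set \<Rightarrow> 'e"
  HUnit :: "'i \<Rightarrow> 'o \<Rightarrow> 'o \<Rightarrow> 'a \<Rightarrow> 'e"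

abbreviation (input) HTensor ::
  "('i, 'j, 'o, 'a, 'e) hdiagram \<Rightarrow> 'i \<Rightarrow> 'i \<Rightarrow> 'i \<Rightarrow> 'j \<Rightarrow> 'j
    \<Rightarrow> ('o, 'a, 'o, 'a, ('o \<times> 'e \<times> 'e) set) profunctor" where
  "HTensor G i j k f g \<equiv> tensor (HOb G i) (HOb G j) (HOb G k) (HPro G j k g) (HPro G i j f)"

text \<open>
  The last three axioms are the associativity and unit coherence conditions of a pseudofunctor,
  evaluated at elements: the associator sends \<open>[d', z, [d, y, x]]\<close> to \<open>[d, [d', z, y], x]\<close>, and the
  unitors act by \<open>[d, f, x] \<mapsto> f x\<close> and \<open>[c, x, a] \<mapsto> x a\<close>.
\<close>

locale is_hdiagram = J: is_category J for J :: "('i, 'j) category" +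
  fixes G :: "('i, 'j, 'o, 'a, 'e) hdiagram"
  assumes HOb_category: "i \<in> Ob J \<Longrightarrow> is_category (HOb G i)"
    and HPro_profunctor:
      "\<lbrakk>i \<in> Ob J; j \<in> Ob J; f \<in> Hom J i j\<rbrakk> \<Longrightarrow> is_profunctor (HOb G i) (HOb G j) (HPro G i j f)"
    and HComp_iso:
      "\<lbrakk>i \<in> Ob J; j \<in> Ob J; k \<in> Ob J; f \<in> Hom J i j; g \<in> Hom J j k\<rbrakk>
        \<Longrightarrow> is_iso_cell (HOb G i) (HOb G k) (HTensor G i j k f g)
              (HPro G i k (Comp J i j k g f)) (HComp G i j k f g)"
    and HUnit_iso:
      "i \<in> Ob J \<Longrightarrow> is_iso_cell (HOb G i) (HOb G i) (hom_profunctor (HOb G i))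
              (HPro G i i (Id J i)) (HUnit G i)"
    and HComp_assoc:
      "\<lbrakk>i \<in> Ob J; j \<in> Ob J; k \<in> Ob J; l \<in> Ob J;
        f \<in> Hom J i j; g \<in> Hom J j k; h \<in> Hom J k l;
        c \<in> Ob (HOb G i); d \<in> Ob (HOb G j); d' \<in> Ob (HOb G k); e \<in> Ob (HOb G l);
        x \<in> El (HPro G i j f) c d; y \<in> El (HPro G j k g) d d'; z \<in> El (HPro G k l h) d' e\<rbrakk>
        \<Longrightarrow> HComp G i k l (Comp J i j k g f) h c e
              (tensor_class (HOb G i) (HOb G k) (HOb G l)
                (HPro G k l h) (HPro G i k (Comp J i j k g f)) c e
                (d', z, HComp G i j k f g c d'
                  (tensor_class (HOb G i) (HOb G j) (HOb G k)
                    (HPro G j k g) (HPro G i j f) c d' (d, y, x))))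
          = HComp G i j l f (Comp J j k l h g) c e
              (tensor_class (HOb G i) (HOb G j) (HOb G l)
                (HPro G j l (Comp J j k l h g)) (HPro G i j f) c e
                (d, HComp G j k l g h d e
                  (tensor_class (HOb G j) (HOb G k) (HOb G l)
                    (HPro G k l h) (HPro G j k g) d e (d', z, y)), x))"
    and HComp_unit_left:
      "\<lbrakk>i \<in> Ob J; j \<in> Ob J; f \<in> Hom J i j;
        c \<in> Ob (HOb G i); d \<in> Ob (HOb G j); d' \<in> Ob (HOb G j);
        x \<in> El (HPro G i j f) c d; b \<in> Hom (HOb G j) d d'\<rbrakk>
        \<Longrightarrow> HComp G i j j f (Id J j) c d'
              (tensor_class (HOb G i) (HOb G j) (HOb G j)
                (HPro G j j (Id J j)) (HPro G i j f) c d' (d, HUnit G j d d' b, x))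
          = Act (HPro G i j f) c d c d' (Id (HOb G i) c) b x"
    and HComp_unit_right:
      "\<lbrakk>i \<in> Ob J; j \<in> Ob J; f \<in> Hom J i j;
        c \<in> Ob (HOb G i); c' \<in> Ob (HOb G i); d \<in> Ob (HOb G j);
        x \<in> El (HPro G i j f) c d; a \<in> Hom (HOb G i) c' c\<rbrakk>
        \<Longrightarrow> HComp G i i j (Id J i) f c' d
              (tensor_class (HOb G i) (HOb G i) (HOb G j)
                (HPro G i j f) (HPro G i i (Id J i)) c' d (c, x, HUnit G i c' c a))
          = Act (HPro G i j f) c d c' d a (Id (HOb G j) d) x"

definition const_hdiagram :: "('o, 'a) category \<Rightarrow> ('i, 'j, 'o, 'a, 'a) hdiagram" where
  "const_hdiagram D =
    \<lparr>HOb = (\<lambda>i. D),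
     HPro = (\<lambda>i j f. hom_profunctor D),
     HComp = (\<lambda>i j k f g. left_unitor D (hom_profunctor D)),
     HUnit = (\<lambda>i. unit_cell id_functor)\<rparr>"

record ('i, 'j, 'o, 'a, 'e, 'p, 'b, 'h) vtransformation =
  VFun :: "'i \<Rightarrow> ('o, 'a, 'p, 'b) functor_data"
  VCell :: "'i \<Rightarrow> 'i \<Rightarrow> 'j \<Rightarrow> 'o \<Rightarrow> 'o \<Rightarrow> 'e \<Rightarrow> 'h"

definition is_vtransformation ::
  "('i, 'j) category \<Rightarrow> ('i, 'j, 'o, 'a, 'e) hdiagram \<Rightarrow> ('i, 'j, 'p, 'b, 'h) hdiagram
    \<Rightarrow> ('i, 'j, 'o, 'a, 'e, 'p, 'b, 'h) vtransformation \<Rightarrow> bool" where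
  "is_vtransformation J G H \<tau> \<longleftrightarrow>
    (\<forall>i\<in>Ob J. is_functor (HOb G i) (HOb H i) (VFun \<tau> i)) \<and>
    (\<forall>i\<in>Ob J. \<forall>j\<in>Ob J. \<forall>f\<in>Hom J i j.
      is_cell (HOb G i) (HOb G j) (VFun \<tau> i) (VFun \<tau> j) (HPro G i j f) (HPro H i j f)
        (VCell \<tau> i j f)) \<and>
    (\<forall>i\<in>Ob J. \<forall>j\<in>Ob J. \<forall>k\<in>Ob J. \<forall>f\<in>Hom J i j. \<forall>g\<in>Hom J j k.
      cell_eq (HOb G i) (HOb G k) (HPro G i k (Comp J i j k g f))
        (vcomp_cell
          (id_functor :: ('o, 'a, 'o, 'a) functor_data) (id_functor :: ('o, 'a, 'o, 'a) functor_data)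
          (vcomp_cell (VFun \<tau> i) (VFun \<tau> k)
            (HComp H i j k f g)
            (hcomp_cell (HOb H i) (HOb H j) (HOb H k) (HPro H j k g) (HPro H i j f)
              (VFun \<tau> i) (VFun \<tau> j) (VFun \<tau> k) (VCell \<tau> j k g) (VCell \<tau> i j f)))
          (inv_cell (HTensor G i j k f g) (HComp G i j k f g)))
        (VCell \<tau> i k (Comp J i j k g f))) \<and>
    (\<forall>i\<in>Ob J.
      cell_eq (HOb G i) (HOb G i) (hom_profunctor (HOb G i))
        (vcomp_cell
          (id_functor :: ('o, 'a, 'o, 'a) functor_data) (id_functor :: ('o, 'a, 'o, 'a) functor_data)
          (VCell \<tau> i i (Id J i)) (HUnit G i))
        (vcomp_cell (VFun \<tau> i) (VFun \<tau> i) (HUnit H i) (unit_cell (VFun \<tau> i))))"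

definition vtransformation_eq ::
  "('i, 'j) category \<Rightarrow> ('i, 'j, 'o, 'a, 'e) hdiagram
    \<Rightarrow> ('i, 'j, 'o, 'a, 'e, 'p, 'b, 'h) vtransformation
    \<Rightarrow> ('i, 'j, 'o, 'a, 'e, 'p, 'b, 'h) vtransformation \<Rightarrow> bool" where
  "vtransformation_eq J G \<sigma> \<tau> \<longleftrightarrow>
    (\<forall>i\<in>Ob J. functor_eq (HOb G i) (VFun \<sigma> i) (VFun \<tau> i)) \<and>
    (\<forall>i\<in>Ob J. \<forall>j\<in>Ob J. \<forall>f\<in>Hom J i j.
      cell_eq (HOb G i) (HOb G j) (HPro G i j f) (VCell \<sigma> i j f) (VCell \<tau> i j f))"

text \<open>The action of a functor on vertical transformations to a constant diagram.\<close>

definition vtransformation_post ::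
  "('p, 'b, 'q, 'c) functor_data \<Rightarrow> ('i, 'j, 'o, 'a, 'e, 'p, 'b, 'b) vtransformation
    \<Rightarrow> ('i, 'j, 'o, 'a, 'e, 'q, 'c, 'c) vtransformation" where
  "vtransformation_post K \<tau> =
    \<lparr>VFun = (\<lambda>i. comp_functor K (VFun \<tau> i)),
     VCell = (\<lambda>i j f. vcomp_cell (VFun \<tau> i) (VFun \<tau> j) (unit_cell K) (VCell \<tau> i j f))\<rparr>"


section \<open>Double colimits\<close>

text \<open>
  A formula of HOL cannot quantify over types, so the types of objects and morphisms of the test
  categories \<open>D\<close> are a parameter.  A claim that \<open>L\<close> and \<open>\<tau>\<close>, which do not depend on it, satisfy
  this for arbitrary type variables is the universal property with respect to all categories.
\<close>

definition is_dcolim ::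
  "('q \<times> 'c) itself \<Rightarrow> ('i, 'j) category \<Rightarrow> ('i, 'j, 'o, 'a, 'e) hdiagram
    \<Rightarrow> ('p, 'b) category \<Rightarrow> ('i, 'j, 'o, 'a, 'e, 'p, 'b, 'b) vtransformation \<Rightarrow> bool" where
  "is_dcolim T J G L \<tau> \<longleftrightarrow>
    is_hdiagram J G \<and> is_category L \<and> is_vtransformation J G (const_hdiagram L) \<tau> \<and>
    (\<forall>(D :: ('q, 'c) category) \<sigma>.
      is_category D \<and> is_vtransformation J G (const_hdiagram D) \<sigma> \<longrightarrow>
      (\<exists>K. is_functor L D K \<and> vtransformation_eq J G (vtransformation_post K \<tau>) \<sigma> \<and>
        (\<forall>K'. is_functor L D K' \<and> vtransformation_eq J G (vtransformation_post K' \<tau>) \<sigma> \<longrightarrow>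
          functor_eq L K' K)))"


section \<open>The diagram of companions\<close>

definition companion ::
  "('p, 'b) category \<Rightarrow> ('o, 'a, 'p, 'b) functor_data \<Rightarrow> ('o, 'a, 'p, 'b, 'b) profunctor" where
  "companion D P =
    \<lparr>El = (\<lambda>c d. Hom D (FOb P c) d),
     Act = (\<lambda>c d c' d' a f x.
       Comp D (FOb P c') d d' f (Comp D (FOb P c') (FOb P c) d x (FHom P c' c a)))\<rparr>"

definition companion_comp ::
  "('q, 'c) category \<Rightarrow> ('o, 'a, 'p, 'b) functor_data \<Rightarrow> ('p, 'b, 'q, 'c) functor_data
    \<Rightarrow> 'o \<Rightarrow> 'q \<Rightarrow> ('p \<times> 'c \<times> 'b) set \<Rightarrow> 'c" where
  "companion_comp E P Q c e X =
    the_elem ((\<lambda>(d, g, f).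
      Comp E (FOb Q (FOb P c)) (FOb Q d) e g (FHom Q (FOb P c) d f)) ` X)"

text \<open>
  The unit comparison is the identity, because the companion of an identity functor is the
  hom-profunctor and \<open>F\<close> preserves identities.
\<close>

definition companion_hdiagram ::
  "('i, 'j, 'o, 'a) diagram \<Rightarrow> ('i, 'j, 'o, 'a, 'a) hdiagram" where
  "companion_hdiagram F =
    \<lparr>HOb = DOb F,
     HPro = (\<lambda>i j \<alpha>. companion (DOb F j) (DArr F i j \<alpha>)),
     HComp = (\<lambda>i j k \<alpha> \<beta>. companion_comp (DOb F k) (DArr F i j \<alpha>) (DArr F j k \<beta>)),
     HUnit = (\<lambda>i. unit_cell id_functor)\<rparr>"

text \<open>
  The canonical vertical transformation to the Grothendieck construction: \<open>x \<mapsto> (i, x)\<close> and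
  \<open>f \<mapsto> (1\<^sub>i, f)\<close> on \<open>F(i)\<close>, while for \<open>\<alpha> : i \<rightarrow> j\<close> the element \<open>f : F\<^sub>\<alpha> x \<rightarrow> y\<close> of the companion
  goes to \<open>(\<alpha>, f)\<close>.
\<close>

definition Gro_cocone ::
  "('i, 'j) category \<Rightarrow> ('i, 'j, 'o, 'a, 'a, 'i \<times> 'o, 'j \<times> 'a, 'j \<times> 'a) vtransformation" where
  "Gro_cocone J =
    \<lparr>VFun = (\<lambda>i. \<lparr>FOb = (\<lambda>x. (i, x)), FHom = (\<lambda>x y f. (Id J i, f))\<rparr>),
     VCell = (\<lambda>i j \<alpha> x y f. (\<alpha>, f))\<rparr>"

end

theory Submission
  imports Defs
begin

text \<open>
  Modulo the relation defining the tensor product, every element \<open>[d, g, f]\<close> of \<open>Q\<^sup>* \<otimes> P\<^sup>*\<close> equals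
  \<open>[P c, g \<circ> Q f, 1]\<close>. Hence the comparison cells are bijective, and a vertical transformation
  \<open>\<sigma>\<close> from \<open>F\<^sup>*\<close> to a constant diagram satisfies the composition law if and only if
  \<open>\<sigma>\<^bsub>\<beta>\<alpha>\<^esub> (g \<circ> F\<^sub>\<beta> f) = \<sigma>\<^sub>\<beta> g \<circ> \<sigma>\<^sub>\<alpha> f\<close>. This is functoriality of the assignment \<open>(\<alpha>, f) \<mapsto> \<sigma>\<^sub>\<alpha> f\<close> on the
  Grothendieck construction, which is the only possible factorisation of \<open>\<sigma>\<close>.
\<close>

section \<open>Tensor products\<close>

text \<open>The reflexive-transitive closure of a symmetrised relation is an equivalence, and it
  stays one when cut down to the square of \<open>tensor_sum\<close>. The quotient in
  \<open>tensor\<close> is therefore a genuine quotient of the sum.\<close>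

lemma equiv_tensor_rel: "equiv (tensor_sum D v u c e) (tensor_rel C D E v u c e)"
proof (rule equivI)
  let ?R = "tensor_gen C D E v u c e"
  have sym: "sym ((?R \<union> ?R\<inverse>)\<^sup>*)"
    by (intro sym_rtrancl) (auto intro: symI)
  show "sym (tensor_rel C D E v u c e)"
    using sym by (auto simp: tensor_rel_def intro!: symI dest: symD)
  show "trans (tensor_rel C D E v u c e)"
    by (rule transI) (auto simp: tensor_rel_def intro: rtrancl_trans)
qed (auto simp: tensor_rel_def refl_on_def)

lemma tensor_class_self:
  "t \<in> tensor_sum D v u c e \<Longrightarrow> t \<in> tensor_class C D E v u c e t"
  by (auto simp: tensor_class_def tensor_rel_def)

lemma tensor_class_subset: "tensor_class C D E v u c e t \<subseteq> tensor_sum D v u c e"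
  by (auto simp: tensor_class_def tensor_rel_def)

lemma tensor_class_closed:
  "t \<in> tensor_sum D v u c e \<Longrightarrow> tensor_class C D E v u c e t \<in> El (tensor C D E v u) c e"
  by (auto simp: tensor_def tensor_class_def intro: quotientI)

lemma tensor_class_cases:
  assumes "X \<in> El (tensor C D E v u) c e"
  obtains d y x where "d \<in> Ob D" "y \<in> El v d e" "x \<in> El u c d"
    "X = tensor_class C D E v u c e (d, y, x)"
  using assms by (auto simp: tensor_def tensor_class_def tensor_sum_def elim!: quotientE)

lemma tensor_class_eqI:
  assumes "(s, t) \<in> tensor_gen C D E v u c e"
    and "s \<in> tensor_sum D v u c e" "t \<in> tensor_sum D v u c e"
  shows "tensor_class C D E v u c e s = tensor_class C D E v u c e t"
  unfolding tensor_class_def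
  using assms by (intro equiv_class_eq[OF equiv_tensor_rel]) (auto simp: tensor_rel_def)

text \<open>Elementwise form of the universal property of the quotient: two members of a class are
  joined by a finite zigzag of generators, and \<open>h\<close> does not change along any of its
  edges. Every well-definedness argument below reduces to checking generators.\<close>

lemma tensor_class_invariant:
  assumes "\<And>s t. (s, t) \<in> tensor_gen C D E v u c e \<Longrightarrow> h s = h t"
    and "s \<in> tensor_class C D E v u c e t"
  shows "h s = h t"
proof -
  let ?R = "tensor_gen C D E v u c e"
  have "(t, s) \<in> (?R \<union> ?R\<inverse>)\<^sup>*"
    using assms(2) by (auto simp: tensor_class_def tensor_rel_def)
  then show ?thesis
    by (induction rule: rtrancl_induct) (auto dest: assms(1))
qed

text \<open>Supplies the singleton that \<open>the_elem\<close> needs when a map out of a tensor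
  product is evaluated at a class.\<close>

lemma image_tensor_class:
  assumes "\<And>s t. (s, t) \<in> tensor_gen C D E v u c e \<Longrightarrow> h s = h t"
    and "t \<in> tensor_sum D v u c e"
  shows "h ` tensor_class C D E v u c e t = {h t}"
  using tensor_class_self[OF assms(2)] tensor_class_invariant[of C D E v u c e h, OF assms(1)]
  by blast

text \<open>
  The map \<open>\<phi>\<close> need not be well defined on classes, because \<open>h\<close> is constant on the union.
\<close>

lemma the_elem_UN_tensor_class:
  assumes "\<And>s t. (s, t) \<in> tensor_gen C D E v u c e \<Longrightarrow> h s = h t"
    and "X \<noteq> {}"
    and "\<And>d y x. (d, y, x) \<in> X \<Longrightarrow> \<phi> d y x \<in> tensor_sum D v u c e \<and> h (\<phi> d y x) = r"
  shows "the_elem (h ` (\<Union>(d, y, x)\<in>X. tensor_class C D E v u c e (\<phi> d y x))) = r"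
proof -
  have im: "h ` tensor_class C D E v u c e (\<phi> d y x) = {r}" if "(d, y, x) \<in> X" for d y x
    using assms(3)[OF that] image_tensor_class[of C D E v u c e h, OF assms(1)] by simp
  have "h ` (\<Union>(d, y, x)\<in>X. tensor_class C D E v u c e (\<phi> d y x))
      = (\<Union>(d, y, x)\<in>X. h ` tensor_class C D E v u c e (\<phi> d y x))"
    by (simp add: image_UN case_prod_unfold)
  also have "\<dots> = (\<Union>t\<in>X. {r})"
    by (intro SUP_cong refl) (clarsimp simp: im)
  also have "\<dots> = {r}"
    using assms(2) by simp
  finally show ?thesis by simp
qed


section \<open>Companions\<close>

lemma companion_simps [simp]:
  "El (companion D P) c d = Hom D (FOb P c) d"
  "Act (companion D P) c d c' d' a f x
    = Comp D (FOb P c') d d' f (Comp D (FOb P c') (FOb P c) d x (FHom P c' c a))"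
  by (simp_all add: companion_def)

lemma companion_profunctor:
  assumes "is_functor C D P"
  shows "is_profunctor C D (companion D P)"
proof -
  interpret is_functor C D P by fact
  show ?thesis
    by unfold_locales
      (simp_all add: FOb_closed FHom_closed FHom_Id FHom_Comp
        D.Comp_closed D.Comp_Id_right D.Comp_Id_left D.Comp_assoc)
qed

text \<open>\<open>F\<close> preserves composites and identities only up to
  \<open>functor_eq\<close>, that is, on the carriers. Being an invertible cell involves values on
  the carriers alone, so it passes from the companion of the composite or identity functor to that
  of the functor which \<open>F\<close> supplies.\<close>

lemma is_iso_cell_companion_cong:
  assumes "functor_eq C R R'" "is_iso_cell C E u (companion E R') t"
  shows "is_iso_cell C E u (companion E R) t"
  using assms
  by (simp add: is_iso_cell_def is_cell_def functor_eq_def id_functor_def)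

section \<open>Comparison cells for a composable pair of companions\<close>

context
  fixes C :: "('o, 'a) category" and D :: "('p, 'b) category" and E :: "('q, 'c) category"
    and P :: "('o, 'a, 'p, 'b) functor_data" and Q :: "('p, 'b, 'q, 'c) functor_data"
  assumes P: "is_functor C D P" and Q: "is_functor D E Q"
begin

interpretation P: is_functor C D P by (rule P)
interpretation Q: is_functor D E Q by (rule Q)

private abbreviation PQ where "PQ \<equiv> tensor C D E (companion E Q) (companion D P)"

private lemmas functor_simps =
  P.FOb_closed P.FHom_closed P.FHom_Id P.FHom_Comp Q.FOb_closed Q.FHom_closed Q.FHom_Id Q.FHom_Comp
  P.C.Id_closed P.D.Id_closed P.D.Comp_closed P.D.Comp_Id_right P.D.Comp_Id_left P.D.Comp_assoc
  Q.D.Id_closed Q.D.Comp_closed Q.D.Comp_Id_right Q.D.Comp_Id_left Q.D.Comp_assoc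

private abbreviation ev where
  "ev c e \<equiv> \<lambda>(d, g, f). Comp E (FOb Q (FOb P c)) (FOb Q d) e g (FHom Q (FOb P c) d f)"

text \<open>On a generator with \<open>f : d -> d'\<close> both sides are the composite of
  \<open>x\<close>, \<open>f\<close> and \<open>y\<close> after applying \<open>Q\<close> to the
  first two, by functoriality of \<open>Q\<close> and associativity in \<open>E\<close>.\<close>

private lemma ev_invariant:
  assumes "c \<in> Ob C" "e \<in> Ob E"
    and "(s, t) \<in> tensor_gen C D E (companion E Q) (companion D P) c e"
  shows "ev c e s = ev c e t"
  using assms by (auto simp: tensor_gen_def functor_simps)

lemma companion_comp_class:
  assumes "c \<in> Ob C" "e \<in> Ob E" "d \<in> Ob D" "g \<in> Hom E (FOb Q d) e" "f \<in> Hom D (FOb P c) d"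
  shows "companion_comp E P Q c e
      (tensor_class C D E (companion E Q) (companion D P) c e (d, g, f))
    = Comp E (FOb Q (FOb P c)) (FOb Q d) e g (FHom Q (FOb P c) d f)"
proof -
  have "(d, g, f) \<in> tensor_sum D (companion E Q) (companion D P) c e"
    using assms by (simp add: tensor_sum_def)
  from image_tensor_class[OF ev_invariant[OF assms(1,2)] this]
  show ?thesis by (simp add: companion_comp_def)
qed

text \<open>A single generator suffices: \<open>f\<close> is its own action on the identity of
  \<open>P c\<close>, regarded as an element of the companion of \<open>P\<close> at
  \<open>(c, P c)\<close>, and so can be moved across the tensor sign onto \<open>g\<close>.\<close>

lemma tensor_class_normal_form:
  assumes "c \<in> Ob C" "e \<in> Ob E" "d \<in> Ob D" "g \<in> Hom E (FOb Q d) e" "f \<in> Hom D (FOb P c) d"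
  shows "tensor_class C D E (companion E Q) (companion D P) c e (d, g, f)
    = tensor_class C D E (companion E Q) (companion D P) c e
        (FOb P c, Comp E (FOb Q (FOb P c)) (FOb Q d) e g (FHom Q (FOb P c) d f), Id D (FOb P c))"
proof (rule tensor_class_eqI)
  have "((d, g, Act (companion D P) c (FOb P c) c d (Id C c) f (Id D (FOb P c))),
      (FOb P c, Act (companion E Q) d e (FOb P c) e f (Id E e) g, Id D (FOb P c)))
    \<in> tensor_gen C D E (companion E Q) (companion D P) c e"
    unfolding tensor_gen_def using assms
    by (intro CollectI exI[of _ "FOb P c"] exI[of _ d] exI[of _ f] exI[of _ "Id D (FOb P c)"]
        exI[of _ g] conjI refl)
      (simp_all add: functor_simps)
  then show "((d, g, f),
      (FOb P c, Comp E (FOb Q (FOb P c)) (FOb Q d) e g (FHom Q (FOb P c) d f), Id D (FOb P c)))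
    \<in> tensor_gen C D E (companion E Q) (companion D P) c e"
    using assms by (simp add: functor_simps)
qed (use assms in \<open>simp_all add: tensor_sum_def functor_simps\<close>)

lemma companion_comp_bij:
  assumes "c \<in> Ob C" "e \<in> Ob E"
  shows "bij_betw (companion_comp E P Q c e) (El PQ c e) (Hom E (FOb Q (FOb P c)) e)"
proof (rule bij_betw_byWitness)
  \<comment> \<open>The inverse reads off the normal form. One composite is the identity by
    \<open>tensor_class_normal_form\<close>, the other because \<open>Q\<close> preserves the
    identity of \<open>P c\<close>.\<close>
  let ?inv = "\<lambda>h. tensor_class C D E (companion E Q) (companion D P) c e (FOb P c, h, Id D (FOb P c))"
  show "\<forall>X\<in>El PQ c e. ?inv (companion_comp E P Q c e X) = X"
  proof
    fix X assume "X \<in> El PQ c e"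
    then obtain d g f where dgf: "d \<in> Ob D" "g \<in> Hom E (FOb Q d) e" "f \<in> Hom D (FOb P c) d"
      and X: "X = tensor_class C D E (companion E Q) (companion D P) c e (d, g, f)"
      by (rule tensor_class_cases) simp
    have cc: "companion_comp E P Q c e X
        = Comp E (FOb Q (FOb P c)) (FOb Q d) e g (FHom Q (FOb P c) d f)"
      unfolding X using assms dgf by (rule companion_comp_class)
    show "?inv (companion_comp E P Q c e X) = X"
      unfolding cc unfolding X using assms dgf by (rule tensor_class_normal_form[symmetric])
  qed
  show "\<forall>h\<in>Hom E (FOb Q (FOb P c)) e. companion_comp E P Q c e (?inv h) = h"
    using assms by (simp add: companion_comp_class functor_simps)
  show "companion_comp E P Q c e ` El PQ c e \<subseteq> Hom E (FOb Q (FOb P c)) e"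
    using assms by (auto simp: companion_comp_class functor_simps elim!: tensor_class_cases)
  show "?inv ` Hom E (FOb Q (FOb P c)) e \<subseteq> El PQ c e"
    using assms
    by (auto intro!: tensor_class_closed simp: tensor_sum_def functor_simps)
qed

lemma companion_comp_natural:
  assumes "c \<in> Ob C" "c' \<in> Ob C" "e \<in> Ob E" "e' \<in> Ob E"
    and "a \<in> Hom C c' c" "b \<in> Hom E e e'" "X \<in> El PQ c e"
  shows "companion_comp E P Q c' e' (Act PQ c e c' e' a b X)
    = Act (companion E (comp_functor Q P)) c e c' e' a b (companion_comp E P Q c e X)"
    (is "_ = ?r")
proof -
  obtain d g f where dgf: "d \<in> Ob D" "g \<in> Hom E (FOb Q d) e" "f \<in> Hom D (FOb P c) d"
    and X: "X = tensor_class C D E (companion E Q) (companion D P) c e (d, g, f)"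
    using assms(7) by (rule tensor_class_cases) simp
  have t: "(d, g, f) \<in> tensor_sum D (companion E Q) (companion D P) c e"
    using dgf by (simp add: tensor_sum_def)
  show ?thesis
    \<comment> \<open>Instantiating the definition at \<open>c'\<close> and \<open>e'\<close> leaves
      the comparison map at \<open>c\<close>, \<open>e\<close> inside \<open>?r\<close>
      folded.\<close>
    unfolding companion_comp_def[of _ _ _ c' e'] tensor_def profunctor.simps
  proof (rule the_elem_UN_tensor_class)
    show "X \<noteq> {}"
      using tensor_class_self[OF t] by (auto simp: X)
    fix d' y x assume mem: "(d', y, x) \<in> X"
    then have ty: "d' \<in> Ob D" "y \<in> Hom E (FOb Q d') e" "x \<in> Hom D (FOb P c) d'"
      using tensor_class_subset unfolding X
      by (fastforce simp: tensor_sum_def)+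
    \<comment> \<open>\<open>Act\<close> on a tensor product is a union over all representatives of
      \<open>X\<close>. Since \<open>ev\<close> does not distinguish them, \<open>?r\<close> can be
      rewritten in terms of the representative at hand, where naturality is a computation in
      \<open>E\<close>.\<close>
    have "ev c e (d', y, x) = ev c e (d, g, f)"
      using tensor_class_invariant[OF ev_invariant[OF assms(1,3)] mem[unfolded X]] .
    then have r: "?r = Act (companion E (comp_functor Q P)) c e c' e' a b (ev c e (d', y, x))"
      by (simp add: X companion_comp_class[OF assms(1,3) dgf])
    show "(d', Act (companion E Q) d' e d' e' (Id D d') b y,
          Act (companion D P) c d' c' d' a (Id D d') x)
        \<in> tensor_sum D (companion E Q) (companion D P) c' e' \<and>
      ev c' e' (d', Act (companion E Q) d' e d' e' (Id D d') b y,
          Act (companion D P) c d' c' d' a (Id D d') x) = ?r"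
      unfolding r using assms(1-6) ty
      by (simp add: tensor_sum_def comp_functor_def functor_simps)
  qed (rule ev_invariant[OF assms(2,4)])
qed

lemma companion_comp_iso:
  "is_iso_cell C E PQ (companion E (comp_functor Q P)) (companion_comp E P Q)"
  unfolding is_iso_cell_def is_cell_def
proof (intro conjI ballI)
  fix c e X assume "c \<in> Ob C" "e \<in> Ob E" "X \<in> El PQ c e"
  then show "companion_comp E P Q c e X
      \<in> El (companion E (comp_functor Q P)) (FOb id_functor c) (FOb id_functor e)"
    using bij_betwE[OF companion_comp_bij]
    by (simp add: comp_functor_def id_functor_def)
next
  fix c e assume "c \<in> Ob C" "e \<in> Ob E"
  from companion_comp_bij[OF this]
  show "bij_betw (companion_comp E P Q c e) (El PQ c e) (El (companion E (comp_functor Q P)) c e)"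
    by (simp add: comp_functor_def)
qed (use companion_comp_natural in \<open>simp add: id_functor_def\<close>)

end


section \<open>Cells into horizontal units\<close>

lemma is_cell_closed:
  assumes "is_cell C D P Q u v t" "c \<in> Ob C" "d \<in> Ob D" "x \<in> El u c d"
  shows "t c d x \<in> El v (FOb P c) (FOb Q d)"
  using assms unfolding is_cell_def by blast

lemma is_cell_natural:
  assumes "is_cell C D P Q u v t"
    and "c \<in> Ob C" "c' \<in> Ob C" "d \<in> Ob D" "d' \<in> Ob D"
    and "a \<in> Hom C c' c" "f \<in> Hom D d d'" "x \<in> El u c d"
  shows "t c' d' (Act u c d c' d' a f x)
    = Act v (FOb P c) (FOb Q d) (FOb P c') (FOb Q d') (FHom P c' c a) (FHom Q d d' f) (t c d x)"
  using assms unfolding is_cell_def by blast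

lemma hom_profunctor_simps [simp]:
  "El (hom_profunctor C) = Hom C"
  "Act (hom_profunctor C) c d c' d' a f x = Comp C c' d d' f (Comp C c' c d x a)"
  by (simp_all add: hom_profunctor_def)

section \<open>Horizontal composites of cells with values in hom-sets\<close>

context
  fixes C :: "('o, 'a) category" and D :: "('p, 'b) category" and E :: "('q, 'c) category"
    and X :: "('r, 'd) category"
    and u :: "('o, 'a, 'p, 'b, 'e) profunctor" and v :: "('p, 'b, 'q, 'c, 'h) profunctor"
    and P :: "('o, 'a, 'r, 'd) functor_data" and Q :: "('p, 'b, 'r, 'd) functor_data"
    and R :: "('q, 'c, 'r, 'd) functor_data"
    and t :: "'o \<Rightarrow> 'p \<Rightarrow> 'e \<Rightarrow> 'd" and s :: "'p \<Rightarrow> 'q \<Rightarrow> 'h \<Rightarrow> 'd"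
  assumes P: "is_functor C X P" and Q: "is_functor D X Q" and R: "is_functor E X R"
    and t: "is_cell C D P Q u (hom_profunctor X) t" and s: "is_cell D E Q R v (hom_profunctor X) s"
begin

interpretation P: is_functor C X P by (rule P)
interpretation Q: is_functor D X Q by (rule Q)
interpretation R: is_functor E X R by (rule R)

private lemmas hom_cell_simps =
  P.FOb_closed P.FHom_Id Q.FOb_closed Q.FHom_closed R.FOb_closed R.FHom_Id
  is_cell_closed[OF t, simplified] is_cell_closed[OF s, simplified]
  P.D.Id_closed P.D.Comp_closed P.D.Comp_Id_left P.D.Comp_Id_right P.D.Comp_assoc

private abbreviation comp_cells where
  "comp_cells c e \<equiv> \<lambda>(d, y, x). Comp X (FOb P c) (FOb Q d) (FOb R e) (s d e y) (t c d x)"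

text \<open>Naturality of \<open>t\<close> in its second variable turns \<open>t (f x)\<close> into
  \<open>Q f\<close> after \<open>t x\<close>. Naturality of \<open>s\<close> in its first variable
  turns \<open>s (y f)\<close> into \<open>s y\<close> after \<open>Q f\<close>. Both sides are then
  \<open>s y\<close>, \<open>Q f\<close>, \<open>t x\<close> composed in \<open>X\<close>.\<close>

private lemma comp_cells_invariant:
  assumes c: "c \<in> Ob C" and e: "e \<in> Ob E" and "(p, q) \<in> tensor_gen C D E v u c e"
  shows "comp_cells c e p = comp_cells c e q"
proof -
  obtain d d' f x y where ty: "d \<in> Ob D" "d' \<in> Ob D" "f \<in> Hom D d d'" "x \<in> El u c d" "y \<in> El v d' e"
    and p: "p = (d', y, Act u c d c d' (Id C c) f x)"
    and q: "q = (d, Act v d' e d e f (Id E e) y, x)"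
    using assms(3) by (auto simp: tensor_gen_def)
  show ?thesis
    using c e ty
    by (simp add: p q is_cell_natural[OF t c c ty(1,2) P.C.Id_closed[OF c] ty(3,4)]
        is_cell_natural[OF s ty(2,1) e e ty(3) R.C.Id_closed[OF e] ty(5)] hom_cell_simps)
qed

private lemma left_unitor_invariant:
  assumes "c \<in> Ob X" "e \<in> Ob X"
    and "(p, q) \<in> tensor_gen X X X (hom_profunctor X) (hom_profunctor X) c e"
  shows "(\<lambda>(d, f, x). Act (hom_profunctor X) c d c e (Id X c) f x) p
    = (\<lambda>(d, f, x). Act (hom_profunctor X) c d c e (Id X c) f x) q"
  using assms by (auto simp: tensor_gen_def hom_cell_simps)

text \<open>For a constant target, horizontal composition followed by the unitor is just composition
  in \<open>X\<close>: \<open>hcomp_cell\<close> ranges over all representatives of the class, and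
  \<open>comp_cells_invariant\<close> gives them one common composite.\<close>

lemma left_unitor_hcomp_cell:
  assumes c: "c \<in> Ob C" and e: "e \<in> Ob E" and d: "d \<in> Ob D" and y: "y \<in> El v d e" and x: "x \<in> El u c d"
  shows "left_unitor X (hom_profunctor X) (FOb P c) (FOb R e)
      (hcomp_cell X X X (hom_profunctor X) (hom_profunctor X) P Q R s t c e
        (tensor_class C D E v u c e (d, y, x)))
    = Comp X (FOb P c) (FOb Q d) (FOb R e) (s d e y) (t c d x)"
  unfolding left_unitor_def hcomp_cell_def
proof (rule the_elem_UN_tensor_class)
  have "(d, y, x) \<in> tensor_sum D v u c e"
    using d y x by (simp add: tensor_sum_def)
  from tensor_class_self[OF this] show "tensor_class C D E v u c e (d, y, x) \<noteq> {}" by blast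
  fix d' y' x' assume mem: "(d', y', x') \<in> tensor_class C D E v u c e (d, y, x)"
  then have ty: "d' \<in> Ob D" "y' \<in> El v d' e" "x' \<in> El u c d'"
    using subsetD[OF tensor_class_subset mem] by (simp_all add: tensor_sum_def)
  have "comp_cells c e (d', y', x') = comp_cells c e (d, y, x)"
    using comp_cells_invariant[OF c e] mem by (rule tensor_class_invariant)
  with c e ty show "(FOb Q d', s d' e y', t c d' x')
      \<in> tensor_sum X (hom_profunctor X) (hom_profunctor X) (FOb P c) (FOb R e) \<and>
    (\<lambda>(d, f, x). Act (hom_profunctor X) (FOb P c) d (FOb P c) (FOb R e) (Id X (FOb P c)) f x)
      (FOb Q d', s d' e y', t c d' x')
    = Comp X (FOb P c) (FOb Q d) (FOb R e) (s d e y) (t c d x)"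
    by (simp add: tensor_sum_def hom_cell_simps)
qed (rule left_unitor_invariant[OF P.FOb_closed[OF c] R.FOb_closed[OF e]])

end

text \<open>Eliminates the inverse comparison cell from the composition law. As \<open>w\<close> is
  a bijection, each \<open>h\<close> is \<open>w Z\<close> for a unique \<open>Z\<close>, and each
  \<open>Z\<close> is the class of some triple.\<close>

lemma ball_inv_cell_tensor_iff:
  assumes w: "bij_betw (w c e) (El (tensor C D E v u) c e) H"
  shows "(\<forall>h\<in>H. g (inv_cell (tensor C D E v u) w c e h) = k h) \<longleftrightarrow>
    (\<forall>d\<in>Ob D. \<forall>x\<in>El u c d. \<forall>y\<in>El v d e.
      k (w c e (tensor_class C D E v u c e (d, y, x))) = g (tensor_class C D E v u c e (d, y, x)))"
    (is "?L \<longleftrightarrow> ?R")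
proof -
  let ?T = "El (tensor C D E v u) c e"
  have inv: "inv_cell (tensor C D E v u) w c e (w c e Z) = Z" if "Z \<in> ?T" for Z
    unfolding inv_cell_def using w that by (simp add: inv_into_f_f bij_betw_imp_inj_on)
  have "?L \<longleftrightarrow> (\<forall>Z\<in>?T. g Z = k (w c e Z))"
    unfolding bij_betw_imp_surj_on[OF w, symmetric] by (simp add: inv)
  also have "\<dots> \<longleftrightarrow> ?R"
  proof (intro iffI ballI)
    fix d x y
    assume all: "\<forall>Z\<in>?T. g Z = k (w c e Z)" and "d \<in> Ob D" "x \<in> El u c d" "y \<in> El v d e"
    then have "tensor_class C D E v u c e (d, y, x) \<in> ?T"
      by (intro tensor_class_closed) (simp add: tensor_sum_def)
    then show "k (w c e (tensor_class C D E v u c e (d, y, x)))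
        = g (tensor_class C D E v u c e (d, y, x))"
      using all by (blast intro: sym)
  next
    fix Z assume R: "?R" and "Z \<in> ?T"
    from this(2) obtain d y x where "d \<in> Ob D" "y \<in> El v d e" "x \<in> El u c d"
      and "Z = tensor_class C D E v u c e (d, y, x)"
      by (rule tensor_class_cases)
    with R show "g Z = k (w c e Z)" by (blast intro: sym)
  qed
  finally show ?thesis .
qed


section \<open>The diagram of companions\<close>

context
  fixes J :: "('i, 'j) category" and F :: "('i, 'j, 'o, 'a) diagram"
  assumes Cat_diagram: "is_Cat_diagram J F"
begin

interpretation is_Cat_diagram J F by (rule Cat_diagram)

lemmas diagram_simps [simp] =
  J.Id_closed J.Comp_closed J.Comp_Id_right J.Comp_Id_left J.Comp_assoc
  is_category.Id_closed[OF DOb_category] is_category.Comp_closed[OF DOb_category]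
  is_category.Comp_Id_right[OF DOb_category] is_category.Comp_Id_left[OF DOb_category]
  is_category.Comp_assoc[OF DOb_category]
  is_functor.FOb_closed[OF DArr_functor] is_functor.FHom_closed[OF DArr_functor]
  is_functor.FHom_Id[OF DArr_functor] is_functor.FHom_Comp[OF DArr_functor]

lemma FOb_DArr_Id [simp]:
  "\<lbrakk>i \<in> Ob J; x \<in> Ob (DOb F i)\<rbrakk> \<Longrightarrow> FOb (DArr F i i (Id J i)) x = x"
  using DArr_Id by (simp add: functor_eq_def id_functor_def)

lemma FHom_DArr_Id [simp]:
  "\<lbrakk>i \<in> Ob J; x \<in> Ob (DOb F i); y \<in> Ob (DOb F i); f \<in> Hom (DOb F i) x y\<rbrakk>
    \<Longrightarrow> FHom (DArr F i i (Id J i)) x y f = f"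
  using DArr_Id by (simp add: functor_eq_def id_functor_def)

lemma FOb_DArr_Comp [simp]:
  "\<lbrakk>i \<in> Ob J; j \<in> Ob J; k \<in> Ob J; \<alpha> \<in> Hom J i j; \<beta> \<in> Hom J j k; x \<in> Ob (DOb F i)\<rbrakk>
    \<Longrightarrow> FOb (DArr F i k (Comp J i j k \<beta> \<alpha>)) x = FOb (DArr F j k \<beta>) (FOb (DArr F i j \<alpha>) x)"
  using DArr_Comp by (simp add: functor_eq_def comp_functor_def)

lemma FHom_DArr_Comp [simp]:
  "\<lbrakk>i \<in> Ob J; j \<in> Ob J; k \<in> Ob J; \<alpha> \<in> Hom J i j; \<beta> \<in> Hom J j k;
    x \<in> Ob (DOb F i); y \<in> Ob (DOb F i); f \<in> Hom (DOb F i) x y\<rbrakk>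
    \<Longrightarrow> FHom (DArr F i k (Comp J i j k \<beta> \<alpha>)) x y f
      = FHom (DArr F j k \<beta>) (FOb (DArr F i j \<alpha>) x) (FOb (DArr F i j \<alpha>) y)
          (FHom (DArr F i j \<alpha>) x y f)"
  using DArr_Comp by (simp add: functor_eq_def comp_functor_def)

lemmas companion_comp_DArr [simp] = companion_comp_class[OF DArr_functor DArr_functor]

lemma companion_comp_iso_DArr:
  assumes "i \<in> Ob J" "j \<in> Ob J" "k \<in> Ob J" "\<alpha> \<in> Hom J i j" "\<beta> \<in> Hom J j k"
  shows "is_iso_cell (DOb F i) (DOb F k)
    (tensor (DOb F i) (DOb F j) (DOb F k)
      (companion (DOb F k) (DArr F j k \<beta>)) (companion (DOb F j) (DArr F i j \<alpha>)))
    (companion (DOb F k) (DArr F i k (Comp J i j k \<beta> \<alpha>)))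
    (companion_comp (DOb F k) (DArr F i j \<alpha>) (DArr F j k \<beta>))"
  by (rule is_iso_cell_companion_cong[OF DArr_Comp companion_comp_iso])
    (simp_all add: assms DArr_functor)

lemma companion_hdiagram: "is_hdiagram J (companion_hdiagram F)"
proof (intro is_hdiagram.intro is_hdiagram_axioms.intro)
  fix i assume i: "i \<in> Ob J"
  then show "is_category (HOb (companion_hdiagram F) i)"
    by (simp add: companion_hdiagram_def DOb_category)
  \<comment> \<open>The identity cell is checked for the companion of \<open>id_functor\<close>
    itself and then carried over to the functor assigned to \<open>Id J i\<close>.\<close>
  have "is_iso_cell (DOb F i) (DOb F i) (hom_profunctor (DOb F i)) (companion (DOb F i) id_functor)
      (unit_cell id_functor)"
    by (simp add: is_iso_cell_def is_cell_def id_functor_def unit_cell_def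
        hom_profunctor_def bij_betw_def inj_on_def)
  from is_iso_cell_companion_cong[OF DArr_Id[OF i] this]
  show "is_iso_cell (HOb (companion_hdiagram F) i) (HOb (companion_hdiagram F) i)
      (hom_profunctor (HOb (companion_hdiagram F) i)) (HPro (companion_hdiagram F) i i (Id J i))
      (HUnit (companion_hdiagram F) i)"
    by (simp add: companion_hdiagram_def)
\<comment> \<open>In the coherence laws \<open>companion_comp_DArr\<close> evaluates the comparison
  cells at classes of triples. What remains are category laws in the fibres and functoriality of the
  functors between them.\<close>
qed (simp_all add: companion_hdiagram_def companion_comp_iso_DArr J.is_category_axioms
      companion_profunctor DArr_functor,
    simp_all add: unit_cell_def id_functor_def)

text \<open>Makes the axioms elementwise. The composition law is rewritten by
  \<open>ball_inv_cell_tensor_iff\<close> and \<open>left_unitor_hcomp_cell\<close>; the unit law is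
  immediate because both unit comparisons are identities.\<close>

lemma is_vtransformation_const_iff:
  assumes "is_category D"
  shows "is_vtransformation J (companion_hdiagram F) (const_hdiagram D) \<tau> \<longleftrightarrow>
    (\<forall>i\<in>Ob J. is_functor (DOb F i) D (VFun \<tau> i)) \<and>
    (\<forall>i\<in>Ob J. \<forall>j\<in>Ob J. \<forall>\<alpha>\<in>Hom J i j.
      is_cell (DOb F i) (DOb F j) (VFun \<tau> i) (VFun \<tau> j)
        (companion (DOb F j) (DArr F i j \<alpha>)) (hom_profunctor D) (VCell \<tau> i j \<alpha>)) \<and>
    (\<forall>i\<in>Ob J. \<forall>j\<in>Ob J. \<forall>k\<in>Ob J. \<forall>\<alpha>\<in>Hom J i j. \<forall>\<beta>\<in>Hom J j k.
      \<forall>x\<in>Ob (DOb F i). \<forall>z\<in>Ob (DOb F k). \<forall>y\<in>Ob (DOb F j).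
      \<forall>f\<in>Hom (DOb F j) (FOb (DArr F i j \<alpha>) x) y. \<forall>g\<in>Hom (DOb F k) (FOb (DArr F j k \<beta>) y) z.
        VCell \<tau> i k (Comp J i j k \<beta> \<alpha>) x z
          (Comp (DOb F k) (FOb (DArr F j k \<beta>) (FOb (DArr F i j \<alpha>) x)) (FOb (DArr F j k \<beta>) y) z
            g (FHom (DArr F j k \<beta>) (FOb (DArr F i j \<alpha>) x) y f))
        = Comp D (FOb (VFun \<tau> i) x) (FOb (VFun \<tau> j) y) (FOb (VFun \<tau> k) z)
            (VCell \<tau> j k \<beta> y z g) (VCell \<tau> i j \<alpha> x y f)) \<and>
    (\<forall>i\<in>Ob J. \<forall>x\<in>Ob (DOb F i). \<forall>y\<in>Ob (DOb F i). \<forall>f\<in>Hom (DOb F i) x y.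
      VCell \<tau> i i (Id J i) x y f = FHom (VFun \<tau> i) x y f)"
    (is "_ \<longleftrightarrow> ?fun \<and> ?cell \<and> ?comp \<and> ?unit")
proof -
  let ?lhs = "\<lambda>i j k \<alpha> \<beta> x z.
      \<forall>h\<in>El (companion (DOb F k) (DArr F i k (Comp J i j k \<beta> \<alpha>))) x z.
        left_unitor D (hom_profunctor D) (FOb (VFun \<tau> i) x) (FOb (VFun \<tau> k) z)
          (hcomp_cell D D D (hom_profunctor D) (hom_profunctor D) (VFun \<tau> i) (VFun \<tau> j) (VFun \<tau> k)
            (VCell \<tau> j k \<beta>) (VCell \<tau> i j \<alpha>) x z
            (inv_cell (tensor (DOb F i) (DOb F j) (DOb F k)
                (companion (DOb F k) (DArr F j k \<beta>)) (companion (DOb F j) (DArr F i j \<alpha>)))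
              (companion_comp (DOb F k) (DArr F i j \<alpha>) (DArr F j k \<beta>)) x z h))
          = VCell \<tau> i k (Comp J i j k \<beta> \<alpha>) x z h"
  let ?rhs = "\<lambda>i j k \<alpha> \<beta> x z. \<forall>y\<in>Ob (DOb F j).
      \<forall>f\<in>Hom (DOb F j) (FOb (DArr F i j \<alpha>) x) y. \<forall>g\<in>Hom (DOb F k) (FOb (DArr F j k \<beta>) y) z.
        VCell \<tau> i k (Comp J i j k \<beta> \<alpha>) x z
          (Comp (DOb F k) (FOb (DArr F j k \<beta>) (FOb (DArr F i j \<alpha>) x)) (FOb (DArr F j k \<beta>) y) z
            g (FHom (DArr F j k \<beta>) (FOb (DArr F i j \<alpha>) x) y f))
        = Comp D (FOb (VFun \<tau> i) x) (FOb (VFun \<tau> j) y) (FOb (VFun \<tau> k) z)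
            (VCell \<tau> j k \<beta> y z g) (VCell \<tau> i j \<alpha> x y f)"
  have law: "(\<forall>x\<in>Ob (DOb F i). \<forall>z\<in>Ob (DOb F k). ?lhs i j k \<alpha> \<beta> x z) \<longleftrightarrow>
      (\<forall>x\<in>Ob (DOb F i). \<forall>z\<in>Ob (DOb F k). ?rhs i j k \<alpha> \<beta> x z)"
    if "?fun" "?cell" and ij: "i \<in> Ob J" "j \<in> Ob J" "k \<in> Ob J" "\<alpha> \<in> Hom J i j" "\<beta> \<in> Hom J j k"
    for i j k \<alpha> \<beta>
  proof (intro ball_cong refl)
    note F\<alpha> = DArr_functor[OF ij(1,2,4)] and F\<beta> = DArr_functor[OF ij(2,3,5)]
    fix x z assume x: "x \<in> Ob (DOb F i)" and z: "z \<in> Ob (DOb F k)"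
    let ?u = "companion (DOb F j) (DArr F i j \<alpha>)" and ?v = "companion (DOb F k) (DArr F j k \<beta>)"
    have "is_cell (DOb F i) (DOb F j) (VFun \<tau> i) (VFun \<tau> j) ?u (hom_profunctor D) (VCell \<tau> i j \<alpha>)"
      and "is_cell (DOb F j) (DOb F k) (VFun \<tau> j) (VFun \<tau> k) ?v (hom_profunctor D) (VCell \<tau> j k \<beta>)"
      and "is_functor (DOb F i) D (VFun \<tau> i)" "is_functor (DOb F j) D (VFun \<tau> j)"
        "is_functor (DOb F k) D (VFun \<tau> k)"
      using that by blast+
    note hcomp_value = left_unitor_hcomp_cell[OF this(3-5,1,2) x z, unfolded companion_simps]
    \<comment> \<open>Splitting the functor of the composite arrow on \<open>x\<close> makes the
      range of \<open>h\<close> literally the codomain in \<open>companion_comp_bij\<close>, so that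
      \<open>law_iff\<close> applies.\<close>
    have El: "El (companion (DOb F k) (DArr F i k (Comp J i j k \<beta> \<alpha>))) x z
        = Hom (DOb F k) (FOb (DArr F j k \<beta>) (FOb (DArr F i j \<alpha>) x)) z"
      using ij x by simp
    note law_iff = ball_inv_cell_tensor_iff[
        where w = "companion_comp (DOb F k) (DArr F i j \<alpha>) (DArr F j k \<beta>)"
          and g = "\<lambda>Z. left_unitor D (hom_profunctor D) (FOb (VFun \<tau> i) x) (FOb (VFun \<tau> k) z)
            (hcomp_cell D D D (hom_profunctor D) (hom_profunctor D) (VFun \<tau> i) (VFun \<tau> j)
              (VFun \<tau> k) (VCell \<tau> j k \<beta>) (VCell \<tau> i j \<alpha>) x z Z)"
          and k = "VCell \<tau> i k (Comp J i j k \<beta> \<alpha>) x z",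
        OF companion_comp_bij[OF F\<alpha> F\<beta> x z]]
    show "?lhs i j k \<alpha> \<beta> x z \<longleftrightarrow> ?rhs i j k \<alpha> \<beta> x z"
      unfolding El law_iff unfolding companion_simps
      by (intro ball_cong refl)
        (simp only: hcomp_value companion_comp_class[OF F\<alpha> F\<beta> x z])
  qed
  show ?thesis
    unfolding is_vtransformation_def cell_eq_def vcomp_cell_def companion_hdiagram_def
      const_hdiagram_def hdiagram.select_convs id_functor_def functor_data.select_convs
      unit_cell_def hom_profunctor_simps
    \<comment> \<open>\<open>conj_cong\<close> provides the functor and cell clauses as assumptions
      for the composition clause, which is where \<open>law\<close> needs them.\<close>
    by (intro conj_cong refl ball_cong law)
qed


section \<open>The universal property of the Grothendieck construction\<close>

lemma Gro_simps:
  "Ob (Gro J F) = (SIGMA i : Ob J. Ob (DOb F i))"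
  "Hom (Gro J F) (i, x) (j, y) = (SIGMA \<alpha> : Hom J i j. Hom (DOb F j) (FOb (DArr F i j \<alpha>) x) y)"
  "Id (Gro J F) (i, x) = (Id J i, Id (DOb F i) x)"
  "Comp (Gro J F) (i, x) (j, y) (k, z) (\<beta>, g) (\<alpha>, f) =
    (Comp J i j k \<beta> \<alpha>,
     Comp (DOb F k) (FOb (DArr F j k \<beta>) (FOb (DArr F i j \<alpha>) x)) (FOb (DArr F j k \<beta>) y) z
       g (FHom (DArr F j k \<beta>) (FOb (DArr F i j \<alpha>) x) y f))"
  by (simp_all add: Gro_def)

text \<open>The fibre components match on the nose because \<open>F\<close> is strict: the left
  identity law uses \<open>FHom_DArr_Id\<close>, the right one that each transition functor
  preserves identities, and associativity uses \<open>FHom_DArr_Comp\<close>.\<close>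

lemma Gro_category: "is_category (Gro J F)"
  by unfold_locales (auto simp: Gro_simps)

text \<open>In elementwise form the composition law is the definition of composition in
  \<open>Gro\<close>. Naturality is the computation of \<open>(1, b) (\<alpha>, f) (1, a)\<close>
  there.\<close>

lemma Gro_cocone: "is_vtransformation J (companion_hdiagram F) (const_hdiagram (Gro J F)) (Gro_cocone J)"
  unfolding is_vtransformation_const_iff[OF Gro_category]
proof (intro conjI ballI)
  fix i assume i: "i \<in> Ob J"
  interpret G: is_category "Gro J F" by (rule Gro_category)
  interpret C: is_category "DOb F i" using i by (rule DOb_category)
  show "is_functor (DOb F i) (Gro J F) (VFun (Gro_cocone J) i)"
    using i by unfold_locales (simp_all add: Gro_cocone_def Gro_simps)
qed (simp_all add: is_cell_def Gro_cocone_def Gro_simps)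

text \<open>The functors \<open>VFun \<sigma> i\<close> enter on objects only; their action on
  morphisms is recovered from the cells at \<open>Id J i\<close> through the unit law.\<close>

definition Gro_induced ::
  "('i, 'j, 'o, 'a, 'a, 'q, 'c, 'c) vtransformation \<Rightarrow> ('i \<times> 'o, 'j \<times> 'a, 'q, 'c) functor_data" where
  "Gro_induced \<sigma> =
    \<lparr>FOb = (\<lambda>(i, x). FOb (VFun \<sigma> i) x), FHom = (\<lambda>(i, x) (j, y) (\<alpha>, f). VCell \<sigma> i j \<alpha> x y f)\<rparr>"

text \<open>The first and last clauses prescribe \<open>K\<close> on every object and every morphism
  of \<open>Gro\<close>, which gives uniqueness of the factorisation. For \<open>Gro_induced\<close>
  they hold by definition, and the middle clause is the unit law of \<open>\<sigma>\<close>.\<close>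

lemma vtransformation_eq_post_Gro_cocone_iff:
  "vtransformation_eq J (companion_hdiagram F) (vtransformation_post K (Gro_cocone J)) \<sigma> \<longleftrightarrow>
    (\<forall>i\<in>Ob J. \<forall>x\<in>Ob (DOb F i). FOb K (i, x) = FOb (VFun \<sigma> i) x) \<and>
    (\<forall>i\<in>Ob J. \<forall>x\<in>Ob (DOb F i). \<forall>y\<in>Ob (DOb F i). \<forall>f\<in>Hom (DOb F i) x y.
      FHom K (i, x) (i, y) (Id J i, f) = FHom (VFun \<sigma> i) x y f) \<and>
    (\<forall>i\<in>Ob J. \<forall>j\<in>Ob J. \<forall>\<alpha>\<in>Hom J i j. \<forall>x\<in>Ob (DOb F i). \<forall>y\<in>Ob (DOb F j).
      \<forall>f\<in>Hom (DOb F j) (FOb (DArr F i j \<alpha>) x) y.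
        FHom K (i, x) (j, y) (\<alpha>, f) = VCell \<sigma> i j \<alpha> x y f)"
  unfolding vtransformation_eq_def functor_eq_def cell_eq_def
  by (simp add: companion_hdiagram_def vtransformation_post_def Gro_cocone_def comp_functor_def
      vcomp_cell_def unit_cell_def ball_conj_distrib)

lemma Gro_induced_functor:
  assumes D: "is_category D"
    and \<sigma>: "is_vtransformation J (companion_hdiagram F) (const_hdiagram D) \<sigma>"
  shows "is_functor (Gro J F) D (Gro_induced \<sigma>)"
proof -
  interpret G: is_category "Gro J F" by (rule Gro_category)
  interpret D: is_category D by fact
  note \<sigma>' = \<sigma>[unfolded is_vtransformation_const_iff[OF D]]
  have fun_i: "is_functor (DOb F i) D (VFun \<sigma> i)" if "i \<in> Ob J" for i
    using \<sigma>' that by blast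
  have closed: "VCell \<sigma> i j \<alpha> x y f \<in> Hom D (FOb (VFun \<sigma> i) x) (FOb (VFun \<sigma> j) y)"
    if "i \<in> Ob J" "j \<in> Ob J" "\<alpha> \<in> Hom J i j" "x \<in> Ob (DOb F i)" "y \<in> Ob (DOb F j)"
      "f \<in> Hom (DOb F j) (FOb (DArr F i j \<alpha>) x) y" for i j \<alpha> x y f
    using is_cell_closed[of "DOb F i" "DOb F j" "VFun \<sigma> i" "VFun \<sigma> j"
        "companion (DOb F j) (DArr F i j \<alpha>)" "hom_profunctor D" "VCell \<sigma> i j \<alpha>" x y f] \<sigma>' that
    by auto
  have comp: "VCell \<sigma> i k (Comp J i j k \<beta> \<alpha>) x z
        (Comp (DOb F k) (FOb (DArr F j k \<beta>) (FOb (DArr F i j \<alpha>) x)) (FOb (DArr F j k \<beta>) y) z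
          g (FHom (DArr F j k \<beta>) (FOb (DArr F i j \<alpha>) x) y f))
      = Comp D (FOb (VFun \<sigma> i) x) (FOb (VFun \<sigma> j) y) (FOb (VFun \<sigma> k) z)
          (VCell \<sigma> j k \<beta> y z g) (VCell \<sigma> i j \<alpha> x y f)"
    if "i \<in> Ob J" "j \<in> Ob J" "k \<in> Ob J" "\<alpha> \<in> Hom J i j" "\<beta> \<in> Hom J j k"
      "x \<in> Ob (DOb F i)" "y \<in> Ob (DOb F j)" "z \<in> Ob (DOb F k)"
      "f \<in> Hom (DOb F j) (FOb (DArr F i j \<alpha>) x) y" "g \<in> Hom (DOb F k) (FOb (DArr F j k \<beta>) y) z"
    for i j k \<alpha> \<beta> x y z f g
    using \<sigma>' that by blast
  \<comment> \<open>At an identity \<open>f\<close> this reduces preservation of identities by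
    \<open>Gro_induced\<close> to that by \<open>VFun \<sigma> i\<close>.\<close>
  have unit: "VCell \<sigma> i i (Id J i) x y f = FHom (VFun \<sigma> i) x y f"
    if "i \<in> Ob J" "x \<in> Ob (DOb F i)" "y \<in> Ob (DOb F i)" "f \<in> Hom (DOb F i) x y" for i x y f
    using \<sigma>' that by blast
  show ?thesis
    by unfold_locales
      (auto simp: Gro_induced_def Gro_simps closed comp unit
        is_functor.FOb_closed[OF fun_i] is_functor.FHom_Id[OF fun_i])
qed

lemma Gro_is_dcolim:
  "is_dcolim TYPE('q \<times> 'c) J (companion_hdiagram F) (Gro J F) (Gro_cocone J)"
  unfolding is_dcolim_def
proof (intro conjI allI impI)
  fix D :: "('q, 'c) category" and \<sigma>
  assume asm: "is_category D \<and> is_vtransformation J (companion_hdiagram F) (const_hdiagram D) \<sigma>"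
  then have D: "is_category D"
    and \<sigma>: "is_vtransformation J (companion_hdiagram F) (const_hdiagram D) \<sigma>"
    by blast+
  from \<sigma> have "\<forall>i\<in>Ob J. \<forall>x\<in>Ob (DOb F i). \<forall>y\<in>Ob (DOb F i). \<forall>f\<in>Hom (DOb F i) x y.
      VCell \<sigma> i i (Id J i) x y f = FHom (VFun \<sigma> i) x y f"
    unfolding is_vtransformation_const_iff[OF D] by blast
  then have "vtransformation_eq J (companion_hdiagram F)
      (vtransformation_post (Gro_induced \<sigma>) (Gro_cocone J)) \<sigma>"
    unfolding vtransformation_eq_post_Gro_cocone_iff by (simp add: Gro_induced_def)
  moreover have "functor_eq (Gro J F) K (Gro_induced \<sigma>)"
    if "vtransformation_eq J (companion_hdiagram F) (vtransformation_post K (Gro_cocone J)) \<sigma>" for K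
    using that unfolding vtransformation_eq_post_Gro_cocone_iff
    by (auto simp: functor_eq_def Gro_induced_def Gro_simps)
  ultimately show "\<exists>K. is_functor (Gro J F) D K \<and>
      vtransformation_eq J (companion_hdiagram F) (vtransformation_post K (Gro_cocone J)) \<sigma> \<and>
      (\<forall>K'. is_functor (Gro J F) D K' \<and>
        vtransformation_eq J (companion_hdiagram F) (vtransformation_post K' (Gro_cocone J)) \<sigma> \<longrightarrow>
        functor_eq (Gro J F) K' K)"
    using Gro_induced_functor[OF D \<sigma>] by blast
qed (rule companion_hdiagram Gro_category Gro_cocone)+

end


section \<open>Uniqueness of double colimits\<close>

lemma id_functor_functor: "is_category C \<Longrightarrow> is_functor C C id_functor"
  by (simp add: is_functor_def is_functor_axioms_def id_functor_def)

lemma comp_functor_functor: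
  assumes "is_functor C D P" "is_functor D E Q"
  shows "is_functor C E (comp_functor Q P)"
proof -
  interpret P: is_functor C D P by fact
  interpret Q: is_functor D E Q by fact
  show ?thesis
    by unfold_locales
      (simp_all add: comp_functor_def P.FOb_closed P.FHom_closed P.FHom_Id P.FHom_Comp
        Q.FOb_closed Q.FHom_closed Q.FHom_Id Q.FHom_Comp)
qed

lemma vtransformation_post_id: "vtransformation_eq J G (vtransformation_post id_functor \<tau>) \<tau>"
  by (simp add: vtransformation_eq_def functor_eq_def cell_eq_def vtransformation_post_def
      comp_functor_def id_functor_def vcomp_cell_def unit_cell_def)

lemma vtransformation_post_comp:
  "vtransformation_post (comp_functor Q P) \<tau> = vtransformation_post Q (vtransformation_post P \<tau>)"
  by (simp add: vtransformation_post_def comp_functor_def vcomp_cell_def unit_cell_def)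

lemma vtransformation_eq_trans:
  "vtransformation_eq J G \<rho> \<sigma> \<Longrightarrow> vtransformation_eq J G \<sigma> \<tau> \<Longrightarrow> vtransformation_eq J G \<rho> \<tau>"
  by (simp add: vtransformation_eq_def functor_eq_def cell_eq_def)

lemma vtransformation_eq_post:
  "vtransformation_eq J G \<sigma> \<tau>
    \<Longrightarrow> vtransformation_eq J G (vtransformation_post K \<sigma>) (vtransformation_post K \<tau>)"
  by (simp add: vtransformation_eq_def functor_eq_def cell_eq_def vtransformation_post_def
      comp_functor_def vcomp_cell_def)

lemma is_dcolim_factor:
  fixes D :: "('q, 'c) category"
  assumes "is_dcolim TYPE('q \<times> 'c) J G L \<tau>"
    and "is_category D" "is_vtransformation J G (const_hdiagram D) \<sigma>"
  obtains K where "is_functor L D K" "vtransformation_eq J G (vtransformation_post K \<tau>) \<sigma>"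
  using assms unfolding is_dcolim_def by blast

text \<open>Both \<open>K\<close> and the identity factor \<open>\<tau>\<close> through itself, so
  each agrees with the unique factorisation \<open>K0\<close>. The test category is
  \<open>L\<close>, hence the type parameter is that of \<open>L\<close>.\<close>

lemma is_dcolim_endofunctor:
  fixes L :: "('p, 'b) category"
  assumes L: "is_dcolim TYPE('p \<times> 'b) J G L \<tau>"
    and K: "is_functor L L K" "vtransformation_eq J G (vtransformation_post K \<tau>) \<tau>"
  shows "functor_eq L K id_functor"
proof -
  have "is_category L" and "is_vtransformation J G (const_hdiagram L) \<tau>"
    using L unfolding is_dcolim_def by blast+
  then obtain K0 where K0: "\<And>K'. is_functor L L K' \<Longrightarrow>
      vtransformation_eq J G (vtransformation_post K' \<tau>) \<tau> \<Longrightarrow> functor_eq L K' K0"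
    using L unfolding is_dcolim_def by blast
  have "functor_eq L id_functor K0"
    using \<open>is_category L\<close>
    by (intro K0 id_functor_functor vtransformation_post_id)
  with K0[OF K] show ?thesis
    by (simp add: functor_eq_def)
qed

text \<open>The universal property is relative to the types of the test categories. A competing
  \<open>L\<close> is tested at the types of \<open>Gro\<close> to obtain a functor to
  \<open>Gro\<close>, and at its own types to identify the composite on \<open>L\<close> with the
  identity.\<close>

theorem theorem1:
  fixes J :: "('i, 'j) category"
    and F :: "('i, 'j, 'o, 'a) diagram"
  assumes "is_Cat_diagram J F"
  shows "is_dcolim TYPE('q \<times> 'c) J (companion_hdiagram F) (Gro J F) (Gro_cocone J) \<and>
    (\<forall>(L :: ('q, 'c) category) \<tau>.
      is_dcolim TYPE('q \<times> 'c) J (companion_hdiagram F) L \<tau> \<and>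
      is_dcolim TYPE(('i \<times> 'o) \<times> ('j \<times> 'a)) J (companion_hdiagram F) L \<tau> \<longrightarrow>
      isomorphic_categories (Gro J F) L)"
proof (intro conjI allI impI)
  let ?G = "companion_hdiagram F" and ?L = "Gro J F" and ?\<kappa> = "Gro_cocone J"
  show dcolim: "is_dcolim TYPE('q \<times> 'c) J ?G ?L ?\<kappa>"
    using assms by (rule Gro_is_dcolim)
  fix L :: "('q, 'c) category" and \<tau>
  assume "is_dcolim TYPE('q \<times> 'c) J ?G L \<tau> \<and> is_dcolim TYPE(('i \<times> 'o) \<times> ('j \<times> 'a)) J ?G L \<tau>"
  then have L: "is_dcolim TYPE('q \<times> 'c) J ?G L \<tau>" "is_dcolim TYPE(('i \<times> 'o) \<times> ('j \<times> 'a)) J ?G L \<tau>"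
    by blast+
  have cat: "is_category ?L" "is_category L"
    and cocone: "is_vtransformation J ?G (const_hdiagram ?L) ?\<kappa>"
      "is_vtransformation J ?G (const_hdiagram L) \<tau>"
    using dcolim L(1) unfolding is_dcolim_def by blast+
  obtain P where P: "is_functor ?L L P" "vtransformation_eq J ?G (vtransformation_post P ?\<kappa>) \<tau>"
    using dcolim cat(2) cocone(2) by (rule is_dcolim_factor)
  obtain Q where Q: "is_functor L ?L Q" "vtransformation_eq J ?G (vtransformation_post Q \<tau>) ?\<kappa>"
    using L(2) cat(1) cocone(1) by (rule is_dcolim_factor)
  have "vtransformation_eq J ?G (vtransformation_post (comp_functor Q P) ?\<kappa>) ?\<kappa>"
    using P(2) Q(2)
    by (metis vtransformation_post_comp vtransformation_eq_trans vtransformation_eq_post)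
  \<comment> \<open>Here \<open>Gro\<close> is itself the test category, so
    \<open>Gro_is_dcolim\<close> is invoked anew at its own types; \<open>dcolim\<close> speaks of
    the types of \<open>L\<close>.\<close>
  then have "functor_eq ?L (comp_functor Q P) id_functor"
    by (rule is_dcolim_endofunctor[OF Gro_is_dcolim[OF assms] comp_functor_functor[OF P(1) Q(1)]])
  moreover have "vtransformation_eq J ?G (vtransformation_post (comp_functor P Q) \<tau>) \<tau>"
    unfolding vtransformation_post_comp
    using vtransformation_eq_post[OF Q(2)] P(2) by (rule vtransformation_eq_trans)
  then have "functor_eq L (comp_functor P Q) id_functor"
    by (rule is_dcolim_endofunctor[OF L(1) comp_functor_functor[OF Q(1) P(1)]])
  ultimately show "isomorphic_categories ?L L"
    using P(1) Q(1) unfolding isomorphic_categories_def by blast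
qed

end
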